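(* For every $d\ge 3$ there is a constant $c=c(d)$ such that for all $n$, $OT_d(n)\le \mathrm{twr}_d(n^c)$.
   Context: The tower function is defined by $\mathrm{twr}_1(x)=x$ and $\mathrm{twr}_{i+1}(x)=2^{\mathrm{twr}_i(x)}$. A point set in $\mathbb{R}^d$ is in general position if no $d+1$ of its points lie on a common hyperplane. For an ordered point set $P=\{p_1,\dots,p_N\}\subset\mathbb{R}^d$ and indices $i_1<\dots<i_{d+1}$, let $M$ be the $(d+1)\times(d+1)$ matrix whose $j$-th column is $(1,p_{i_j})$ (a $1$ followed by the $d$ coordinates of $p_{i_j}$); the tuple $(p_{i_1},\dots,p_{i_{d+1}})$ has positive orientation if $\det M>0$ and negative orientation if $\det M<0$. $OT_d(n)$ is the smallest integer $N$ such that any (ordered) set of $N$ points in general position in $\mathbb{R}^d$ contains $n$ members such that every $(d+1)$-tuple of them (in increasing index order) has the same orientation. *)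

theory Defs
  imports Complex_Main "Jordan_Normal_Form.Determinant" "HOL-Library.Sublist" "HOL-Library.Ramsey"
begin

text \<open>The tower function, indexed from 1; the value at index 0 is irrelevant.\<close>

fun twr :: "nat \<Rightarrow> real \<Rightarrow> real" where
  "twr 0 x = 0"
| "twr (Suc 0) x = x"
| "twr (Suc (Suc i)) x = 2 powr twr (Suc i) x"

text \<open>Points of $d$-dimensional space are elements of \<^term>\<open>carrier_vec d :: real vec set\<close>.\<close>

definition is_hyperplane :: "nat \<Rightarrow> real vec set \<Rightarrow> bool" where
  "is_hyperplane d H \<longleftrightarrow>
     (\<exists>a \<in> carrier_vec d. \<exists>b. a \<noteq> 0\<^sub>v d \<and> H = {x \<in> carrier_vec d. a \<bullet> x = b})"

definition general_position :: "nat \<Rightarrow> real vec set \<Rightarrow> bool" where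
  "general_position d S \<longleftrightarrow>
     (\<forall>T \<subseteq> S. card T = d + 1 \<longrightarrow> \<not> (\<exists>H. is_hyperplane d H \<and> T \<subseteq> H))"

text \<open>An ordered point set is a list of distinct points; its ordered subsets are
  the lists \<^term>\<open>qs\<close> with \<^term>\<open>subseq qs P\<close>.\<close>

definition ordered_point_set :: "nat \<Rightarrow> real vec list \<Rightarrow> bool" where
  "ordered_point_set d P \<longleftrightarrow> distinct P \<and> set P \<subseteq> carrier_vec d"

definition orientation_matrix :: "nat \<Rightarrow> real vec list \<Rightarrow> real mat" where
  "orientation_matrix d ts = mat_of_cols (d + 1) (map (vCons 1) ts)"

definition positive_orientation :: "nat \<Rightarrow> real vec list \<Rightarrow> bool" where
  "positive_orientation d ts \<longleftrightarrow> det (orientation_matrix d ts) > 0"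

definition negative_orientation :: "nat \<Rightarrow> real vec list \<Rightarrow> bool" where
  "negative_orientation d ts \<longleftrightarrow> det (orientation_matrix d ts) < 0"

definition same_orientation :: "nat \<Rightarrow> real vec list \<Rightarrow> bool" where
  "same_orientation d qs \<longleftrightarrow>
     (\<forall>ts. subseq ts qs \<and> length ts = d + 1 \<longrightarrow> positive_orientation d ts) \<or>
     (\<forall>ts. subseq ts qs \<and> length ts = d + 1 \<longrightarrow> negative_orientation d ts)"

definition forces_same_orientation :: "nat \<Rightarrow> nat \<Rightarrow> nat \<Rightarrow> bool" where
  "forces_same_orientation d n N \<longleftrightarrow>
     (\<forall>P. ordered_point_set d P \<and> length P = N \<and> general_position d (set P) \<longrightarrow>
        (\<exists>qs. subseq qs P \<and> length qs = n \<and> same_orientation d qs))"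

definition OT :: "nat \<Rightarrow> nat \<Rightarrow> nat" where
  "OT d n = (LEAST N. forces_same_orientation d n N)"

text \<open>The rest of the theory shows that the minimum defining \<^const>\<open>OT\<close> is attained.\<close>

lemma orientation_matrix_carrier:
  "length ts = d + 1 \<Longrightarrow> orientation_matrix d ts \<in> carrier_mat (d + 1) (d + 1)"
  unfolding orientation_matrix_def by (metis length_map mat_of_cols_carrier(1))

lemma det_orientation_matrix_nonzero:
  assumes gp: "general_position d S" and S: "S \<subseteq> carrier_vec d"
    and ts: "set ts \<subseteq> S" "distinct ts" "length ts = d + 1"
  shows "det (orientation_matrix d ts) \<noteq> 0"
proof
  define M where "M = orientation_matrix d ts"
  assume "det (orientation_matrix d ts) = 0"
  moreover have M: "M \<in> carrier_mat (d + 1) (d + 1)"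
    using orientation_matrix_carrier[OF ts(3)] by (simp add: M_def)
  ultimately have "det M\<^sup>T = 0" using det_transpose[OF M] by (simp add: M_def)
  then obtain v where v: "v \<in> carrier_vec (d + 1)" "v \<noteq> 0\<^sub>v (d + 1)" "M\<^sup>T *\<^sub>v v = 0\<^sub>v (d + 1)"
    using det_0_iff_vec_prod_zero_field[of "M\<^sup>T" "d + 1"] M by auto
  obtain c a where va: "v = vCons c a" and a: "a \<in> carrier_vec d"
    using v(1) by (cases v) auto
  have eq: "c + a \<bullet> x = 0" if x: "x \<in> set ts" for x
  proof -
    obtain j where j: "j < d + 1" "ts ! j = x" using x ts(3) by (metis in_set_conv_nth)
    have xc: "x \<in> carrier_vec d" using x ts S by auto
    have "row M\<^sup>T j = vCons 1 x"
    proof -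
      have "row M\<^sup>T j = col M j" using M j by simp
      also have "\<dots> = vCons 1 x"
        unfolding M_def orientation_matrix_def using j ts(3) xc
        by (subst col_mat_of_cols) auto
      finally show ?thesis .
    qed
    moreover have "row M\<^sup>T j \<bullet> v = 0"
      using arg_cong[OF v(3), of "\<lambda>w. w $ j"] j M by simp
    ultimately have "vCons 1 x \<bullet> vCons c a = 0" using va by simp
    then have "c + x \<bullet> a = 0" using scalar_prod_vCons by simp
    then show ?thesis using comm_scalar_prod[OF xc a] by simp
  qed
  have "a \<noteq> 0\<^sub>v d"
  proof
    assume a0: "a = 0\<^sub>v d"
    obtain x where x: "x \<in> set ts" using ts(3) by (cases ts) auto
    then have "x \<in> carrier_vec d" using ts S by auto
    then have "c = 0" using eq[OF x] a0 by simp
    then have "v = 0\<^sub>v (d + 1)" using va a0 by (auto simp: vec_index_vCons intro!: eq_vecI)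
    then show False using v(2) by simp
  qed
  then have "is_hyperplane d {x \<in> carrier_vec d. a \<bullet> x = - c}"
    unfolding is_hyperplane_def using a by blast
  moreover have "set ts \<subseteq> {x \<in> carrier_vec d. a \<bullet> x = - c}"
    using eq ts S by (force simp: eq_neg_iff_add_eq_0 add.commute)
  moreover have "card (set ts) = d + 1" using ts distinct_card by force
  ultimately show False using gp ts(1) unfolding general_position_def by blast
qed

lemma forces_same_orientation_exists: "\<exists>N. forces_same_orientation d n N"
proof -
  obtain N :: nat where N: "partn_lst {..<N} [n, n] (d + 1)"
    using ramsey_full by blast
  have "\<exists>qs. subseq qs P \<and> length qs = n \<and> same_orientation d qs"
    if P: "ordered_point_set d P" "length P = N" "general_position d (set P)" for P
  proof -
    define f where "f e = (if positive_orientation d (nths P e) then 0 else 1 :: nat)" for e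
    have "f \<in> nsets {..<N} (d + 1) \<rightarrow> {..<2}" by (auto simp: f_def)
    then obtain i H where i: "i < 2" and H: "H \<in> nsets {..<N} ([n, n] ! i)"
      and mono: "f ` nsets H (d + 1) \<subseteq> {i}"
      by (rule partn_lstE[OF N]) (simp_all add: numeral_2_eq_2)
    have HN: "H \<subseteq> {..<N}" "card H = n" "finite H"
      using H i by (auto simp: nsets_def less_2_cases_iff)
    have len: "length (nths P e) = card e" if "e \<subseteq> H" for e
    proof -
      have "{i. i < length P \<and> i \<in> e} = e" using that HN(1) P(2) by auto
      then show ?thesis by (simp add: length_nths)
    qed
    have sub: "\<exists>e \<in> nsets H (d + 1). ts = nths P e"
      if ts: "subseq ts (nths P H)" "length ts = d + 1" for ts
    proof -
      obtain B where B: "ts = nths (nths P H) B" using ts(1) subseq_conv_nths by blast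
      define e where "e = {i \<in> H. \<exists>j \<in> B. card {i' \<in> H. i' < i} = j}"
      have e: "e \<subseteq> H" "ts = nths P e"
        unfolding e_def using B by (blast, simp only: nths_nths)
      have "card e = d + 1" using len[OF e(1)] e(2) ts(2) by simp
      then have "e \<in> nsets H (d + 1)"
        using e(1) HN(3) finite_subset[of e H] unfolding nsets_def by blast
      then show ?thesis using e(2) by blast
    qed
    have nz: "positive_orientation d ts \<or> negative_orientation d ts"
      if ts: "subseq ts (nths P H)" "length ts = d + 1" for ts
    proof -
      have "subseq ts P"
        using ts(1) subseq_conv_nths[of "nths P H" P] subseq_order.order_trans[of ts "nths P H" P]
        by blast
      then obtain B where "ts = nths P B" using subseq_conv_nths by blast
      then have "set ts \<subseteq> set P" "distinct ts"
        using P(1) set_nths_subset[of P B] by (simp_all add: ordered_point_set_def)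
      then have "det (orientation_matrix d ts) \<noteq> 0"
        using det_orientation_matrix_nonzero[OF P(3)] ts(2) P(1)
        unfolding ordered_point_set_def by blast
      then show ?thesis
        unfolding positive_orientation_def negative_orientation_def by linarith
    qed
    have "same_orientation d (nths P H)"
    proof (cases "i = 0")
      case True
      have "positive_orientation d ts"
        if ts: "subseq ts (nths P H)" "length ts = d + 1" for ts
      proof -
        obtain e where e: "e \<in> nsets H (d + 1)" "ts = nths P e" using sub[OF ts] by blast
        then have "f e = 0" using mono True by blast
        then show ?thesis using e(2) by (simp add: f_def split: if_splits)
      qed
      then show ?thesis unfolding same_orientation_def by blast
    next
      case False
      have "negative_orientation d ts"
        if ts: "subseq ts (nths P H)" "length ts = d + 1" for ts
      proof -
        obtain e where e: "e \<in> nsets H (d + 1)" "ts = nths P e" using sub[OF ts] by blast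
        then have "f e \<noteq> 0" using mono False by blast
        then show ?thesis using nz[OF ts] e(2) by (simp add: f_def split: if_splits)
      qed
      then show ?thesis unfolding same_orientation_def by blast
    qed
    moreover have "subseq (nths P H) P" using subseq_conv_nths by blast
    ultimately show ?thesis using len[of H] HN(2) by auto
  qed
  then show ?thesis unfolding forces_same_orientation_def by blast
qed

lemma OT_forces: "forces_same_orientation d n (OT d n)"
  unfolding OT_def using forces_same_orientation_exists by (rule LeastI_ex)

end

theory Submission
  imports Defs
begin

text \<open>
  Homogenise: a point \<open>p\<close> becomes the vector \<open>(1, p)\<close>, and the orientation of \<open>d + 1\<close> points is the
  sign of a determinant of \<open>d + 1\<close> vectors. The Erdos--Rado argument passes to a sublist on
  which the sign of a tuple does not depend on its last entry, so that the last column may be taken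
  to be one fixed vector; each such step costs one exponential. After \<open>d - 1\<close> steps only two columns
  \<open>x, y\<close> are free, and \<open>b(x, y) = det [x, y, Q]\<close> satisfies the three-term Grassmann--Pluecker
  relation. Hence \<open>b > 0\<close> is transitive on the points \<open>x\<close> for which \<open>b(x, w)\<close> has a given
  sign, where \<open>w\<close> is the last point, and the Erdos--Szekeres theorem yields a polynomial bound, with
  no exponential at all. In total this is a tower of height \<open>d\<close>.
\<close>

section \<open>End-homogeneous sublists\<close>

lemma set_subseq: "subseq xs ys \<Longrightarrow> set xs \<subseteq> set ys"
  by (metis subseq_conv_nths set_nths_subset)

text \<open>The class sizes add up to the length of the list. Classes are formed by
  \<open>filter\<close>, so the surviving candidates keep their order.\<close>

lemma pigeonhole_filter:
  assumes fin: "finite C" and ne: "C \<noteq> {}" and sub: "f ` set xs \<subseteq> C"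
    and len: "card C * m \<le> length xs"
  obtains c where "c \<in> C" "m \<le> length (filter (\<lambda>x. f x = c) xs)"
proof -
  have "(\<Sum>c\<in>C. length (filter (\<lambda>x. f x = c) xs)) = length xs"
    using sub
  proof (induction xs)
    case (Cons x xs)
    have "(\<Sum>c\<in>C. length (filter (\<lambda>x. f x = c) (x # xs)))
        = (\<Sum>c\<in>C. (if f x = c then 1 else 0) + length (filter (\<lambda>x. f x = c) xs))"
      by (intro sum.cong) auto
    then show ?case using Cons fin by (simp add: sum.distrib)
  qed simp
  moreover have "(\<Sum>c\<in>C. length (filter (\<lambda>x. f x = c) xs)) < card C * m"
    if "\<And>c. c \<in> C \<Longrightarrow> length (filter (\<lambda>x. f x = c) xs) < m"
    using sum_strict_mono[OF fin ne that] by simp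
  ultimately show thesis using that len by (metis leD not_le)
qed

text \<open>The list \<open>us\<close> holds the points already chosen and \<open>S\<close> the candidates, which
  the tuples over \<^term>\<open>us\<close> cannot tell apart. A chosen point costs a factor two and a split
  into at most \<open>2 ^ (n ^ k)\<close> classes.\<close>

lemma end_homogeneous_extension:
  fixes E :: "'a list \<Rightarrow> bool"
  assumes "length us + m \<le> n"
    and "2 ^ (m * (n ^ k + 1)) \<le> length S"
    and "\<And>T y z. length T = k \<Longrightarrow> set T \<subseteq> set us \<Longrightarrow> y \<in> set S \<Longrightarrow> z \<in> set S \<Longrightarrow>
           E (T @ [y]) = E (T @ [z])"
  shows "\<exists>vs q. subseq (vs @ [q]) S \<and> length vs = m \<and>
           (\<forall>vs1 vs2 T y. vs = vs1 @ vs2 \<and> length T = k \<and> set T \<subseteq> set us \<union> set vs1 \<and> y \<in> set vs2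
              \<longrightarrow> E (T @ [y]) = E (T @ [q]))"
  using assms
proof (induction m arbitrary: us S)
  case 0
  then obtain q where "q \<in> set S" by (cases S) auto
  then show ?case by (intro exI[of _ "[]"] exI[of _ q]) (auto simp: subseq_singleton_left)
next
  case (Suc m)
  obtain x S' where S: "S = x # S'"
    using Suc.prems(2) by (cases S) auto
  define Ts where "Ts = {T. set T \<subseteq> set (us @ [x]) \<and> length T = k}"
  have finTs: "finite Ts" unfolding Ts_def by (intro finite_lists_length_eq) simp
  have "card Ts = card (set (us @ [x])) ^ k" unfolding Ts_def by (intro card_lists_length_eq) simp
  also have "\<dots> \<le> n ^ k"
    using card_length[of "us @ [x]"] Suc.prems(1) by (intro power_mono) auto
  finally have cardTs: "card Ts \<le> n ^ k" .
  have "(2::nat) ^ card Ts * 2 ^ (m * (n ^ k + 1)) \<le> 2 ^ (n ^ k) * 2 ^ (m * (n ^ k + 1))"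
    using cardTs by (intro mult_right_mono power_increasing) auto
  moreover have "2 * (2 ^ (n ^ k) * 2 ^ (m * (n ^ k + 1))) \<le> length S"
    using Suc.prems(2) by (simp add: power_add mult_ac)
  \<comment> \<open>This lower bound turns \<open>2 * a \<le> length S\<close> into
    \<open>a \<le> length S'\<close>, although \<open>x\<close> is gone.\<close>
  moreover have "(1::nat) \<le> 2 ^ (n ^ k) * 2 ^ (m * (n ^ k + 1))" by simp
  ultimately have "2 ^ card Ts * 2 ^ (m * (n ^ k + 1)) \<le> length S'"
    unfolding S list.size(4) by linarith
  then have len: "card (Pow Ts) * 2 ^ (m * (n ^ k + 1)) \<le> length S'"
    using finTs by (simp add: card_Pow)
  \<comment> \<open>The type of \<open>y\<close>: the tuples over the chosen points, now including
    \<open>x\<close>, that accept \<open>y\<close> as last entry. A constant type restores the third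
    premise.\<close>
  define f where "f y = {T \<in> Ts. E (T @ [y])}" for y
  obtain c where c: "2 ^ (m * (n ^ k + 1)) \<le> length (filter (\<lambda>y. f y = c) S')"
    using finTs len by (rule_tac pigeonhole_filter[of "Pow Ts" f S']) (auto simp: f_def)
  let ?R = "filter (\<lambda>y. f y = c) S'"
  have "E (T @ [y]) = E (T @ [z])"
    if "length T = k" "set T \<subseteq> set (us @ [x])" "y \<in> set ?R" "z \<in> set ?R" for T y z
  proof -
    have "f y = f z" "T \<in> Ts" using that by (auto simp: Ts_def)
    then show ?thesis unfolding f_def by blast
  qed
  moreover have "length (us @ [x]) + m \<le> n" using Suc.prems(1) by simp
  ultimately obtain vs q where vs: "subseq (vs @ [q]) ?R" "length vs = m"
    and hom: "\<And>vs1 vs2 T y. vs = vs1 @ vs2 \<Longrightarrow> length T = k \<Longrightarrow>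
       set T \<subseteq> set (us @ [x]) \<union> set vs1 \<Longrightarrow> y \<in> set vs2 \<Longrightarrow> E (T @ [y]) = E (T @ [q])"
    using Suc.IH[of "us @ [x]" ?R] c by blast
  have "subseq (vs @ [q]) S'" using vs(1) subseq_filter_left subseq_order.order_trans by blast
  then have sub: "subseq ((x # vs) @ [q]) S" unfolding S by simp
  have "E (T @ [y]) = E (T @ [q])"
    if dec: "x # vs = vs1 @ vs2" and T: "length T = k" "set T \<subseteq> set us \<union> set vs1"
      and y: "y \<in> set vs2" for vs1 vs2 T y
  \<comment> \<open>If \<open>vs1\<close> is empty, \<open>T\<close> uses only old points and the
    premise on \<open>S\<close> applies; otherwise \<open>vs1\<close> starts with \<open>x\<close>
    and the recursive choice covers it.\<close>
  proof (cases vs1)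
    case Nil
    have "y \<in> set S" "q \<in> set S" using set_subseq[OF sub] dec Nil y by auto
    then show ?thesis using Suc.prems(3)[of T y q] T Nil by simp
  next
    case (Cons a vs1')
    then show ?thesis using hom[of vs1' vs2 T y] dec T y by auto
  qed
  then show ?case using sub vs(2) by (intro exI[of _ "x # vs"] exI[of _ q]) auto
qed

text \<open>The form used for sublists: in a sublist \<open>T @ [y]\<close> of \<open>vs\<close>,
  all of \<open>T\<close> precedes \<open>y\<close>, so \<open>vs\<close> splits between
  them.\<close>

lemma end_homogeneous:
  fixes E :: "'a list \<Rightarrow> bool"
  assumes "0 < k" and "2 ^ (m * (m ^ k + 1)) \<le> length S"
  obtains vs q where "subseq (vs @ [q]) S" "length vs = m"
    "\<And>T y. subseq (T @ [y]) vs \<Longrightarrow> length T = k \<Longrightarrow> E (T @ [y]) = E (T @ [q])"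
proof -
  obtain vs q where vs: "subseq (vs @ [q]) S" "length vs = m"
    and hom: "\<And>vs1 vs2 T y. vs = vs1 @ vs2 \<Longrightarrow> length T = k \<Longrightarrow> set T \<subseteq> set [] \<union> set vs1 \<Longrightarrow>
       y \<in> set vs2 \<Longrightarrow> E (T @ [y]) = E (T @ [q])"
    \<comment> \<open>With no point chosen yet the third premise is vacuous, as \<open>0 < k\<close>
      excludes tuples over \<open>[]\<close>.\<close>
    using end_homogeneous_extension[of "[]" m m k S E] assms by auto
  show thesis
  proof (rule that[OF vs])
    fix T y assume T: "subseq (T @ [y]) vs" "length T = k"
    then obtain vs1 vs2 where "vs = vs1 @ vs2" "subseq T vs1" "subseq [y] vs2"
      using list_emb_appendD by blast
    then show "E (T @ [y]) = E (T @ [q])"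
      using hom[of vs1 vs2 T y] T(2) by (auto simp: subseq_singleton_left dest: list_emb_set)
  qed
qed

section \<open>Stepping up from pairs to longer tuples\<close>

definition homogeneous :: "('a list \<Rightarrow> bool) \<Rightarrow> nat \<Rightarrow> 'a list \<Rightarrow> bool" where
  "homogeneous E k vs \<longleftrightarrow>
     (\<forall>ts. subseq ts vs \<and> length ts = k \<longrightarrow> E ts) \<or>
     (\<forall>ts. subseq ts vs \<and> length ts = k \<longrightarrow> \<not> E ts)"

text \<open>The length from which tuples of size \<open>j + 2\<close> can be reduced to pairs among
  \<open>r\<close> points. The recursion is the length that \<open>end_homogeneous\<close> asks for,
  with \<open>m\<close> the previous bound and \<open>k = j + 2\<close>.\<close>

fun ramsey_bound :: "nat \<Rightarrow> nat \<Rightarrow> nat" where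
  "ramsey_bound 0 r = r"
| "ramsey_bound (Suc j) r =
     2 ^ (ramsey_bound j r * (ramsey_bound j r ^ (j + 2) + 1))"

text \<open>Induction on \<open>j\<close>: the closing point \<open>q\<close> of an end-homogeneous
  list becomes a fixed last entry of the predicate. These points accumulate in \<open>Q\<close>, and
  \<open>subseq (us @ Q) P\<close> records that they follow \<open>us\<close> in the order of
  \<open>P\<close>.\<close>

lemma homogeneous_step_up:
  assumes "\<And>us Q. subseq (us @ Q) P \<Longrightarrow> length Q = j \<Longrightarrow> r \<le> length us \<Longrightarrow>
             \<exists>vs. subseq vs us \<and> length vs = n \<and> homogeneous (\<lambda>ts. E (ts @ Q)) 2 vs"
    and "ramsey_bound j r \<le> length P"
  shows "\<exists>vs. subseq vs P \<and> length vs = n \<and> homogeneous E (j + 2) vs"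
  using assms
proof (induction j arbitrary: E P)
  case 0
  then show ?case using "0.prems"(1)[of P "[]"] by (simp add: numeral_2_eq_2)
next
  case (Suc j)
  obtain vs q where vs: "subseq (vs @ [q]) P" "length vs = ramsey_bound j r"
    and hom: "\<And>T y. subseq (T @ [y]) vs \<Longrightarrow> length T = j + 2 \<Longrightarrow> E (T @ [y]) = E (T @ [q])"
    using end_homogeneous[where m = "ramsey_bound j r" and k = "j + 2" and S = P and E = E]
      Suc.prems(2) by auto
  have "\<exists>ws. subseq ws us \<and> length ws = n \<and> homogeneous (\<lambda>ts. E ((ts @ Q) @ [q])) 2 ws"
    if "subseq (us @ Q) vs" "length Q = j" "r \<le> length us" for us Q
  proof -
    have "subseq (us @ Q @ [q]) (vs @ [q])" using that(1) by (simp flip: append_assoc)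
    then have "subseq (us @ Q @ [q]) P" using vs(1) subseq_order.order_trans by blast
    then show ?thesis using Suc.prems(1)[of us "Q @ [q]"] that by simp
  qed
  then obtain ws where ws: "subseq ws vs" "length ws = n"
    and ws_hom: "homogeneous (\<lambda>ts. E (ts @ [q])) (j + 2) ws"
    using Suc.IH[of vs "\<lambda>ts. E (ts @ [q])"] vs(2) by auto
  \<comment> \<open>Exchanging the last entry for \<open>q\<close> turns \<open>E\<close> into the
    predicate already known to be homogeneous on \<open>ws\<close>.\<close>
  have last: "\<exists>T. E ts = E (T @ [q]) \<and> subseq T ws \<and> length T = j + 2"
    if ts: "subseq ts ws" "length ts = Suc j + 2" for ts
  proof (cases ts rule: rev_cases)
    case (snoc T y)
    have T: "subseq (T @ [y]) vs" using subseq_order.order_trans[OF ts(1) ws(1)] snoc by simp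
    have "subseq T ts" unfolding snoc by (rule list_emb_prefix) simp
    then have "subseq T ws" using ts(1) subseq_order.order_trans by blast
    moreover have "length T = j + 2" using ts(2) snoc by simp
    ultimately show ?thesis using hom[OF T] snoc by blast
  qed (use ts(2) in simp)
  have "homogeneous E (Suc j + 2) ws"
    using ws_hom unfolding homogeneous_def by (elim disjE) (blast dest: last)+
  moreover have "subseq ws P"
    using subseq_order.order_trans[OF list_emb_prefix[OF ws(1)] vs(1)] .
  ultimately show ?case using ws(2) by blast
qed

section \<open>Erdos--Szekeres for a transitive relation\<close>

text \<open>The elements without an \<open>R\<close>-predecessor form an antichain \<open>M\<close>.
  If it has fewer than \<open>b\<close> elements, it is removed, and a chain among the rest extends
  downwards by one element.\<close>

lemma chain_or_antichain:
  fixes X :: "'a::linorder set"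
  assumes "finite X" "a * b \<le> card X"
    and "\<And>x y z. x \<in> X \<Longrightarrow> y \<in> X \<Longrightarrow> z \<in> X \<Longrightarrow> x < y \<Longrightarrow> y < z \<Longrightarrow> R x y \<Longrightarrow> R y z \<Longrightarrow> R x z"
  shows "(\<exists>H\<subseteq>X. card H = a \<and> (\<forall>x\<in>H. \<forall>y\<in>H. x < y \<longrightarrow> R x y)) \<or>
         (\<exists>H\<subseteq>X. card H = b \<and> (\<forall>x\<in>H. \<forall>y\<in>H. x < y \<longrightarrow> \<not> R x y))"
  using assms
proof (induction a arbitrary: X)
  case 0
  then show ?case by (intro disjI1 exI[of _ "{}"]) simp
next
  case (Suc a)
  define M where "M = {x \<in> X. \<forall>y \<in> X. y < x \<longrightarrow> \<not> R y x}"
  have MX: "M \<subseteq> X" "finite M" using Suc.prems(1) by (auto simp: M_def)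
  show ?case
  proof (cases "b \<le> card M")
    case True
    then obtain H where "H \<subseteq> M" "card H = b" by (meson obtain_subset_with_card_n)
    then show ?thesis using MX by (intro disjI2 exI[of _ H]) (auto simp: M_def)
  next
    case False
    have "card (X - M) = card X - card M" using MX by (simp add: card_Diff_subset)
    then have "a * b \<le> card (X - M)" using False Suc.prems(2) by simp
    then consider H where "H \<subseteq> X - M" "card H = a" "\<forall>x\<in>H. \<forall>y\<in>H. x < y \<longrightarrow> R x y"
      | H where "H \<subseteq> X - M" "card H = b" "\<forall>x\<in>H. \<forall>y\<in>H. x < y \<longrightarrow> \<not> R x y"
      using Suc.IH[of "X - M"] Suc.prems(1,3) by blast
    then show ?thesis
    proof cases
      case 1
      have finH: "finite H" using 1(1) Suc.prems(1) finite_subset by blast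
      show ?thesis
      proof (cases "H = {}")
        case True
        \<comment> \<open>Here \<open>a = 0\<close>, and a single point is a chain of length
          \<open>Suc a\<close>. \<open>False\<close> forces \<open>0 < b\<close>, so
          \<open>X\<close> has one.\<close>
        have "X \<noteq> {}" using Suc.prems(2) False by auto
        then obtain x where "x \<in> X" by blast
        then show ?thesis using 1(2) True by (intro disjI1 exI[of _ "{x}"]) auto
      next
        case nonempty: False
        define z where "z = Min H"
        have z: "z \<in> H" "\<And>x. x \<in> H \<Longrightarrow> z \<le> x" using finH nonempty by (auto simp: z_def)
        \<comment> \<open>The least element \<open>z\<close> lies outside \<open>M\<close>, so it
          has an \<open>R\<close>-predecessor \<open>y\<close>, and transitivity at \<open>z\<close>
          relates \<open>y\<close> to all of \<open>H\<close>.\<close>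
        then obtain y where y: "y \<in> X" "y < z" "R y z" using 1(1) by (auto simp: M_def)
        have Ry: "R y x" if "x \<in> H" for x
          using that y z 1(1,3) Suc.prems(3)[of y z x] by (cases "x = z") fastforce+
        have below: "y < x" if "x \<in> H" for x using z(2)[OF that] y(2) by simp
        have "y \<notin> H" using below by blast
        then have "card (insert y H) = Suc a" using finH 1(2) by simp
        moreover have "\<forall>x\<in>insert y H. \<forall>x'\<in>insert y H. x < x' \<longrightarrow> R x x'"
          using Ry below 1(3) by (auto dest: less_asym)
        ultimately show ?thesis using y(1) 1(1) by (intro disjI1 exI[of _ "insert y H"]) auto
      qed
    next
      case 2
      then show ?thesis by blast
    qed
  qed
qed

lemma sorted_wrt_subseq_pair: "subseq [i, j] ks \<Longrightarrow> sorted_wrt R ks \<Longrightarrow> R i j"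
  by (induction ks) (auto simp: subseq_singleton_left split: if_splits elim: list_emb.cases)

text \<open>The chain argument runs on indices, which are linearly ordered; this carries an index
  set back to a sublist.\<close>

lemma subseq_of_indices:
  assumes H: "H \<subseteq> {..<length xs}"
  obtains vs where "subseq vs xs" "length vs = card H"
    "\<And>ts. subseq ts vs \<Longrightarrow> length ts = 2 \<Longrightarrow> \<exists>i\<in>H. \<exists>j\<in>H. i < j \<and> ts = [xs ! i, xs ! j]"
proof -
  define ks where "ks = filter (\<lambda>i. i \<in> H) [0..<length xs]"
  have "subseq (map ((!) xs) ks) (map ((!) xs) [0..<length xs])"
    unfolding ks_def by (intro subseq_map) simp
  then have sub: "subseq (map ((!) xs) ks) xs" by (simp add: map_nth)
  have set_ks: "set ks = H" using H by (auto simp: ks_def)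
  have srt: "sorted_wrt (<) ks" unfolding ks_def by (intro sorted_wrt_filter) simp
  have len: "length ks = card H"
    using set_ks by (metis ks_def distinct_card distinct_filter distinct_upt)
  show thesis
  proof (rule that[OF sub])
    fix ts assume ts: "subseq ts (map ((!) xs) ks)" "length ts = 2"
    then obtain idx where idx: "ts = map ((!) xs) idx" "subseq idx ks"
      by (auto simp: subseq_conv_nths nths_map)
    then obtain i j where ij: "idx = [i, j]"
      using ts(2) by (auto simp: length_Suc_conv numeral_2_eq_2)
    have "i \<in> H" "j \<in> H" using set_subseq[OF idx(2)] ij set_ks by auto
    moreover have "i < j" using idx(2) srt unfolding ij by (rule sorted_wrt_subseq_pair)
    ultimately show "\<exists>i\<in>H. \<exists>j\<in>H. i < j \<and> ts = [xs ! i, xs ! j]" using idx ij by auto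
  qed (simp add: len)
qed

section \<open>Determinants with two free columns\<close>

lemma det_2x2:
  fixes A :: "'a::comm_ring_1 mat"
  assumes A: "A \<in> carrier_mat 2 2"
  shows "det A = A $$ (0,0) * A $$ (1,1) - A $$ (0,1) * A $$ (1,0)"
proof -
  have "det (mat_delete A 0 j) = mat_delete A 0 j $$ (0, 0)" for j
    using A by (intro det_single) (auto simp: mat_delete_def)
  then show ?thesis
    using A by (simp add: laplace_expansion_row[OF A, of 0] cofactor_def mat_delete_def
        numeral_2_eq_2)
qed

text \<open>The functions \<open>f\<close> and \<open>g\<close> are the first two coordinates in a basis whose other members are
  the fixed columns \<open>Q\<close>.\<close>

lemma det_two_free_columns:
  fixes Q :: "'a::field vec list"
  assumes Q: "set Q \<subseteq> carrier_vec (m + 2)" "length Q = m"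
  obtains C f g where "\<And>z w. z \<in> carrier_vec (m + 2) \<Longrightarrow> w \<in> carrier_vec (m + 2) \<Longrightarrow>
    det (mat_of_cols (m + 2) (z # w # Q)) = C * (f z * g w - f w * g z)"
proof (cases "\<exists>x \<in> carrier_vec (m + 2). \<exists>y \<in> carrier_vec (m + 2).
    det (mat_of_cols (m + 2) (x # y # Q)) \<noteq> 0")
  case False
  \<comment> \<open>The determinant vanishes identically here, so \<open>C = 0\<close> works with
    arbitrary \<open>f\<close> and \<open>g\<close>.\<close>
  then show thesis by (intro that[of 0]) auto
next
  case True
  then obtain x y where xy: "x \<in> carrier_vec (m + 2)" "y \<in> carrier_vec (m + 2)"
    and nz: "det (mat_of_cols (m + 2) (x # y # Q)) \<noteq> 0" by blast
  let ?A = "mat_of_cols (m + 2) (x # y # Q)"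
  have A: "?A \<in> carrier_mat (m + 2) (m + 2)" by (simp add: carrier_matI Q(2))
  obtain B where B: "B \<in> carrier_mat (m + 2) (m + 2)" "B * ?A = 1\<^sub>m (m + 2)"
    using det_non_zero_imp_unit[OF A nz, of "()"] by (auto simp: Units_def ring_mat_def)
  have "det B * det ?A = 1" using det_mult[OF B(1) A] B(2) by simp
  define f where "f v = (B *\<^sub>v v) $ 0" for v
  define g where "g v = (B *\<^sub>v v) $ 1" for v
  have "det (mat_of_cols (m + 2) (z # w # Q)) = det ?A * (f z * g w - f w * g z)"
    if zw: "z \<in> carrier_vec (m + 2)" "w \<in> carrier_vec (m + 2)" for z w
  proof -
    let ?M = "mat_of_cols (m + 2) (z # w # Q)"
    have M: "?M \<in> carrier_mat (m + 2) (m + 2)" by (simp add: carrier_matI Q(2))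
    let ?v = "\<lambda>j::nat. if j = 0 then z else w"
    let ?U = "mat 2 2 (\<lambda>(i, j). (B *\<^sub>v ?v j) $ i)"
    let ?L = "mat m 2 (\<lambda>(i, j). (B *\<^sub>v ?v j) $ (i + 2))"
    \<comment> \<open>Columns from index 2 on are those of \<open>?A\<close>, which \<open>B\<close>
      sends to unit vectors; only the block \<open>?U\<close> affects the determinant.\<close>
    have "B * ?M = four_block_mat ?U (0\<^sub>m 2 m) ?L (1\<^sub>m m)"
    proof (rule eq_matI)
      fix i j
      assume "i < dim_row (four_block_mat ?U (0\<^sub>m 2 m) ?L (1\<^sub>m m))"
        and "j < dim_col (four_block_mat ?U (0\<^sub>m 2 m) ?L (1\<^sub>m m))"
      then have ij: "i < m + 2" "j < m + 2" by auto
      have BM: "(B * ?M) $$ (i, j) = row B i \<bullet> col ?M j"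
        using B(1) M ij by (intro index_mult_mat(1)) auto
      show "(B * ?M) $$ (i, j) = four_block_mat ?U (0\<^sub>m 2 m) ?L (1\<^sub>m m) $$ (i, j)"
      proof (cases "j < 2")
        case True
        then have "col ?M j = ?v j"
          using zw Q(2) by (subst col_mat_of_cols) (auto simp: less_2_cases_iff)
        moreover have "0 < i \<Longrightarrow> i \<noteq> Suc 0 \<Longrightarrow> Suc (Suc (i - 2)) = i" by arith
        ultimately show ?thesis using BM ij True B(1) by (auto simp: less_2_cases_iff)
      next
        case False
        have "Q ! (j - 2) \<in> carrier_vec (m + 2)" using Q False ij by (auto simp: subset_iff)
        then have "col ?M j = col ?A j"
          using Q(2) False ij by (simp add: nth_Cons' numeral_2_eq_2)
        moreover have "(B * ?A) $$ (i, j) = row B i \<bullet> col ?A j"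
          using B(1) A ij by (intro index_mult_mat(1)) auto
        ultimately have "(B * ?M) $$ (i, j) = (B * ?A) $$ (i, j)" using BM by simp
        then show ?thesis using False ij B(2) by auto
      qed
    qed (use B(1) Q(2) in auto)
    then have "det (B * ?M) = det ?U * det (1\<^sub>m m :: 'a mat)"
      using det_four_block_mat_upper_right_zero[of ?U 2 _ m ?L "1\<^sub>m m"] by simp
    also have "\<dots> = f z * g w - f w * g z"
      by (subst det_2x2) (auto simp: f_def g_def)
    finally have "det B * det ?M = f z * g w - f w * g z" using det_mult[OF B(1) M] by simp
    then have "det ?A * (f z * g w - f w * g z) = (det B * det ?A) * det ?M"
      by (metis mult.assoc mult.commute)
    then show ?thesis by (simp only: \<open>det B * det ?A = 1\<close> mult_1_left)
  qed
  then show thesis by (rule that)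
qed


text \<open>In \<open>2 * n\<^sup>2 + 1\<close>, one vector is the reference \<open>us ! l\<close>,
  the factor two pays for fixing the sign of \<open>b i l\<close>, and the remaining
  \<open>n * n\<close> feed \<open>chain_or_antichain\<close>.\<close>

lemma orientation_homogeneous_pairs:
  fixes us Q :: "real vec list"
  assumes us: "set us \<subseteq> carrier_vec (m + 2)" "2 * n\<^sup>2 + 1 \<le> length us"
    and Q: "set Q \<subseteq> carrier_vec (m + 2)" "length Q = m"
    and nz: "\<And>i j. i < j \<Longrightarrow> j < length us \<Longrightarrow> det (mat_of_cols (m + 2) (us ! i # us ! j # Q)) \<noteq> 0"
  shows "\<exists>vs. subseq vs us \<and> length vs = n \<and>
           homogeneous (\<lambda>ts. 0 < det (mat_of_cols (m + 2) (ts @ Q))) 2 vs"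
proof -
  obtain C f g where det_eq: "\<And>z w. z \<in> carrier_vec (m + 2) \<Longrightarrow> w \<in> carrier_vec (m + 2) \<Longrightarrow>
      det (mat_of_cols (m + 2) (z # w # Q)) = C * (f z * g w - f w * g z)"
    using det_two_free_columns[OF Q] by blast
  define b where "b i j = C * (f (us ! i) * g (us ! j) - f (us ! j) * g (us ! i))" for i j
  have b: "det (mat_of_cols (m + 2) (us ! i # us ! j # Q)) = b i j"
    if "i < length us" "j < length us" for i j
    using us(1) that nth_mem[of i us] nth_mem[of j us] unfolding b_def by (intro det_eq) blast+
  define l where "l = length us - 1"
  have l: "l < length us" "2 * n\<^sup>2 \<le> l" using us(2) by (auto simp: l_def)
  have bnz: "b i j \<noteq> 0" if "i < j" "j < length us" for i j
    using nz[OF that] b[of i j] that by simp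
  have grassmann_pluecker: "b i j * b k l + b j k * b i l = b i k * b j l" for i j k
    unfolding b_def by (simp add: algebra_simps)
  \<comment> \<open>The sign \<open>s\<close> is 1 or -1, so both classes share one transitivity
    proof.\<close>
  have "\<exists>s X. X \<subseteq> {..<l} \<and> n * n \<le> card X \<and> (\<forall>i\<in>X. 0 < s * b i l)"
  proof -
    let ?X = "{i \<in> {..<l}. 0 < b i l}" and ?Y = "{i \<in> {..<l}. 0 < - 1 * b i l}"
    have "{..<l} = ?X \<union> ?Y" using bnz l(1) by (auto simp: neq_iff)
    then have "l \<le> card ?X + card ?Y" by (metis card_Un_le card_lessThan)
    then have "n * n \<le> card ?X \<or> n * n \<le> card ?Y" using l(2) by (auto simp: power2_eq_square)
    then show ?thesis
    proof
      assume "n * n \<le> card ?X"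
      then show ?thesis by (intro exI[of _ "1::real"] exI[of _ ?X]) auto
    next
      assume "n * n \<le> card ?Y"
      then show ?thesis by (intro exI[of _ "- 1::real"] exI[of _ ?Y]) auto
    qed
  qed
  then obtain s :: real and X where X: "X \<subseteq> {..<l}" "n * n \<le> card X" "\<And>i. i \<in> X \<Longrightarrow> 0 < s * b i l"
    by blast
  have trans: "0 < b i k"
    if "i \<in> X" "j \<in> X" "k \<in> X" "i < j" "j < k" "0 < b i j" "0 < b j k" for i j k
  proof -
    \<comment> \<open>The relation times \<open>s\<close>: the right side is positive, and so is
      \<open>s * b j l\<close>, which forces \<open>0 < b i k\<close>.\<close>
    have "s * b i k * b j l = b i j * (s * b k l) + b j k * (s * b i l)"
      using arg_cong[OF grassmann_pluecker[of i j k], of "\<lambda>t. s * t"] by (simp add: algebra_simps)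
    moreover have "0 < b i j * (s * b k l) + b j k * (s * b i l)"
      by (rule add_pos_pos[OF mult_pos_pos[OF that(6) X(3)[OF that(3)]]
            mult_pos_pos[OF that(7) X(3)[OF that(1)]]])
    ultimately have "0 < b i k * (s * b j l)" by (simp add: mult_ac)
    then show ?thesis using X(3)[OF that(2)] zero_less_mult_pos2 by blast
  qed
  have "finite X" using X(1) finite_subset by blast
  then have "(\<exists>H\<subseteq>X. card H = n \<and> (\<forall>i\<in>H. \<forall>j\<in>H. i < j \<longrightarrow> 0 < b i j)) \<or>
      (\<exists>H\<subseteq>X. card H = n \<and> (\<forall>i\<in>H. \<forall>j\<in>H. i < j \<longrightarrow> \<not> 0 < b i j))"
    by (rule chain_or_antichain[OF _ X(2) trans])
  then obtain H where H: "H \<subseteq> X" "card H = n"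
    and mono: "(\<forall>i\<in>H. \<forall>j\<in>H. i < j \<longrightarrow> 0 < b i j) \<or> (\<forall>i\<in>H. \<forall>j\<in>H. i < j \<longrightarrow> \<not> 0 < b i j)"
    by metis
  have Hus: "H \<subseteq> {..<length us}" using H(1) X(1) l(1) by auto
  obtain vs where vs: "subseq vs us" "length vs = card H"
    and pairs: "\<And>ts. subseq ts vs \<Longrightarrow> length ts = 2 \<Longrightarrow> \<exists>i\<in>H. \<exists>j\<in>H. i < j \<and> ts = [us ! i, us ! j]"
    by (rule subseq_of_indices[OF Hus]) (rule that)
  have signs: "\<exists>i\<in>H. \<exists>j\<in>H. i < j \<and> det (mat_of_cols (m + 2) (ts @ Q)) = b i j"
    if ts: "subseq ts vs" "length ts = 2" for ts
  proof -
    obtain i j where ij: "i \<in> H" "j \<in> H" "i < j" "ts = [us ! i, us ! j]" using pairs[OF ts] by blast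
    then have "det (mat_of_cols (m + 2) (ts @ Q)) = b i j" using b[of i j] Hus by auto
    then show ?thesis using ij by blast
  qed
  from mono have "homogeneous (\<lambda>ts. 0 < det (mat_of_cols (m + 2) (ts @ Q))) 2 vs"
  proof
    assume "\<forall>i\<in>H. \<forall>j\<in>H. i < j \<longrightarrow> 0 < b i j"
    then have "0 < det (mat_of_cols (m + 2) (ts @ Q))" if "subseq ts vs" "length ts = 2" for ts
      using signs[OF that] by auto
    then show ?thesis unfolding homogeneous_def by blast
  next
    assume "\<forall>i\<in>H. \<forall>j\<in>H. i < j \<longrightarrow> \<not> 0 < b i j"
    then have "\<not> 0 < det (mat_of_cols (m + 2) (ts @ Q))" if "subseq ts vs" "length ts = 2" for ts
      using signs[OF that] by auto
    then show ?thesis unfolding homogeneous_def by blast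
  qed
  then show ?thesis using vs H(2) by auto
qed

section \<open>From determinants to point sets\<close>

text \<open>In dimension \<open>j + 1\<close> a tuple has two free points and a tail
  \<open>Q\<close> of length \<open>j\<close>. General position excludes zero determinants, as the
  pair lemma requires, and later turns non-positive into negative.\<close>

lemma forces_same_orientation_ramsey_bound:
  "forces_same_orientation (j + 1) n (ramsey_bound j (2 * n\<^sup>2 + 1))"
  unfolding forces_same_orientation_def
proof (intro allI impI, elim conjE)
  fix P
  assume P: "ordered_point_set (j + 1) P" "length P = ramsey_bound j (2 * n\<^sup>2 + 1)"
    and gp: "general_position (j + 1) (set P)"
  let ?E = "positive_orientation (j + 1)"
  have carrier: "set P \<subseteq> carrier_vec (j + 1)" and dist: "distinct P"
    using P(1) by (auto simp: ordered_point_set_def)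
  have nz: "det (orientation_matrix (j + 1) ts) \<noteq> 0" if "subseq ts P" "length ts = j + 2" for ts
  proof (rule det_orientation_matrix_nonzero[OF gp carrier])
    show "set ts \<subseteq> set P" using that(1) by (rule set_subseq)
    show "distinct ts" using that(1) dist by (auto simp: subseq_conv_nths)
  qed (use that(2) in simp)
  have base: "\<exists>vs. subseq vs us \<and> length vs = n \<and> homogeneous (\<lambda>ts. ?E (ts @ Q)) 2 vs"
    if sub: "subseq (us @ Q) P" and Q: "length Q = j" and us: "2 * n\<^sup>2 + 1 \<le> length us" for us Q
  proof -
    have setc: "set us \<subseteq> carrier_vec (j + 1)" "set Q \<subseteq> carrier_vec (j + 1)"
      using set_subseq[OF sub] carrier by auto
    have om: "mat_of_cols (j + 2) (map (vCons 1) ts @ map (vCons 1) Q)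
        = orientation_matrix (j + 1) (ts @ Q)" for ts
      by (simp add: orientation_matrix_def)
    have nz': "det (mat_of_cols (j + 2)
        (map (vCons 1) us ! a # map (vCons 1) us ! b # map (vCons 1) Q)) \<noteq> 0"
      if "a < b" "b < length (map (vCons 1) us)" for a b
    proof -
      have "us ! a \<in> set (take b us)" "drop b us = us ! b # drop (Suc b) us"
        using that by (auto simp: in_set_conv_nth Cons_nth_drop_Suc)
      then have "subseq ([us ! a] @ [us ! b]) (take b us @ drop b us)"
        by (intro list_emb_append_mono) (auto simp: subseq_singleton_left)
      then have "subseq [us ! a, us ! b] us" by simp
      then have "subseq ([us ! a, us ! b] @ Q) (us @ Q)" by (intro list_emb_append_mono) simp_all
      then have "subseq ([us ! a, us ! b] @ Q) P" using sub subseq_order.order_trans by blast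
      then have "det (orientation_matrix (j + 1) ([us ! a, us ! b] @ Q)) \<noteq> 0"
        using Q by (intro nz) simp_all
      then show ?thesis
        unfolding om[symmetric] using that by (simp only: list.map append.simps length_map nth_map) simp
    qed
    have "set (map (vCons 1) us) \<subseteq> carrier_vec (j + 2)" "set (map (vCons 1) Q) \<subseteq> carrier_vec (j + 2)"
      using setc by auto
    then obtain ws where ws: "subseq ws (map (vCons 1) us)" "length ws = n"
      and hom: "homogeneous (\<lambda>ts. 0 < det (mat_of_cols (j + 2) (ts @ map (vCons 1) Q))) 2 ws"
      using orientation_homogeneous_pairs[of "map (vCons 1) us" j n "map (vCons 1) Q"] nz' us Q
      unfolding length_map by blast
    \<comment> \<open>The pair lemma selects homogenised vectors; they are pulled back to
      points.\<close>
    obtain vs where vs: "ws = map (vCons 1) vs" "subseq vs us"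
      using ws(1) by (metis subseq_conv_nths nths_map)
    have lift: "subseq (map (vCons 1) ts) ws \<and> length (map (vCons 1) ts) = 2"
      if "subseq ts vs \<and> length ts = 2" for ts
      using that subseq_map[of ts vs] by (simp add: vs(1))
    have "homogeneous (\<lambda>ts. ?E (ts @ Q)) 2 vs"
      using hom lift unfolding homogeneous_def positive_orientation_def om[symmetric] by meson
    then show ?thesis using vs ws(2) by (intro exI[of _ vs]) simp
  qed
  obtain vs where vs: "subseq vs P" "length vs = n" and hom: "homogeneous ?E (j + 2) vs"
    using homogeneous_step_up[OF base eq_refl[OF P(2)[symmetric]]] by blast
  have neg: "negative_orientation (j + 1) ts"
    if "subseq ts vs" "length ts = j + 2" "\<not> ?E ts" for ts
    using nz[OF subseq_order.order_trans[OF that(1) vs(1)] that(2)] that(3)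
    unfolding positive_orientation_def negative_orientation_def by linarith
  have two: "j + 1 + 1 = j + 2" by simp
  have "same_orientation (j + 1) vs"
    using hom neg unfolding homogeneous_def same_orientation_def two by meson
  then show "\<exists>qs. subseq qs P \<and> length qs = n \<and> same_orientation (j + 1) qs"
    by (intro exI[of _ vs] conjI vs)
qed

section \<open>Tower arithmetic\<close>

text \<open>Iterates \<open>t \<le> 2 powr t\<close>, which follows from
  \<open>t \<le> k + 1 \<le> 2 ^ k\<close> for the floor \<open>k\<close> of
  \<open>t\<close>.\<close>

lemma twr_ge:
  assumes "1 \<le> x"
  shows "x \<le> twr (Suc i) x"
proof (induction i)
  case (Suc i)
  have "t \<le> 2 powr t" if "1 \<le> t" for t :: real
  proof -
    define k where "k = nat \<lfloor>t\<rfloor>"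
    have k: "real k \<le> t" "t \<le> real k + 1" using that by (simp_all add: k_def)
    have "k + 1 \<le> 2 ^ k" using Suc_leI[OF less_exp[of k]] by simp
    then have "real (k + 1) \<le> 2 ^ k" by (metis of_nat_le_iff of_nat_numeral of_nat_power)
    also have "\<dots> = 2 powr real k" by (simp add: powr_realpow)
    also have "\<dots> \<le> 2 powr t" using k by (intro powr_mono) auto
    finally show ?thesis using k by simp
  qed
  then show ?case using Suc assms order_trans by fastforce
qed simp

text \<open>Moves an exponent to the innermost argument: \<open>(2 powr t) ^ p\<close> is
  \<open>2 powr (p * t)\<close>, and \<open>p * t \<le> t ^ p\<close> for \<open>2 \<le> t\<close>
  because \<open>p \<le> 2 ^ (p - 1)\<close>.\<close>

lemma twr_power_le:
  assumes x: "2 \<le> x" and p: "1 \<le> p"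
  shows "twr (Suc i) x ^ p \<le> twr (Suc i) (x ^ p)"
proof (induction i)
  case (Suc i)
  define t where "t = twr (Suc i) x"
  have t: "2 \<le> t" using twr_ge[of x i] x by (simp add: t_def)
  have "p \<le> 2 ^ (p - 1)" using less_exp[of "p - 1"] p by linarith
  then have "real p \<le> 2 ^ (p - 1)" by (metis of_nat_le_iff of_nat_numeral of_nat_power)
  also have "\<dots> \<le> t ^ (p - 1)" using t by (intro power_mono) auto
  finally have "real p * t \<le> t ^ (p - 1) * t" using t by (intro mult_right_mono) auto
  also have "\<dots> = t ^ p" using p by (simp add: power_eq_if)
  also have "\<dots> \<le> twr (Suc i) (x ^ p)" using Suc by (simp add: t_def)
  finally have "2 powr (real p * t) \<le> 2 powr twr (Suc i) (x ^ p)" by (intro powr_mono) auto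
  then show ?case by (simp add: t_def powr_power mult.commute)
qed simp

text \<open>The exponent \<open>c\<close> starts at 4 and is multiplied by \<open>j + 4\<close> in
  the step from \<open>j\<close> to \<open>Suc j\<close>. The lower bound 2 is carried along for the
  absorption in that step.\<close>

lemma ramsey_bound_le_twr:
  "\<exists>c\<ge>1. \<forall>n\<ge>2. 2 \<le> ramsey_bound j (2 * n\<^sup>2 + 1) \<and>
     real (ramsey_bound j (2 * n\<^sup>2 + 1)) \<le> twr (Suc j) (real n ^ c)"
proof (induction j)
  case 0
  have "2 * n\<^sup>2 + 1 \<le> n ^ 4" if "2 \<le> n" for n :: nat
  proof -
    have sq: "4 \<le> n\<^sup>2" using power_mono[OF that, of 2] by simp
    then have "4 * n\<^sup>2 \<le> n\<^sup>2 * n\<^sup>2" by (intro mult_right_mono) auto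
    then show ?thesis using sq by (simp flip: power_add)
  qed
  then have "\<forall>n\<ge>2. real (2 * n\<^sup>2 + 1) \<le> real n ^ 4" by (metis of_nat_le_iff of_nat_power)
  then show ?case by (intro exI[of _ 4]) auto
next
  case (Suc j)
  then obtain c where c: "1 \<le> c" and IH: "\<And>n. 2 \<le> n \<Longrightarrow> 2 \<le> ramsey_bound j (2 * n\<^sup>2 + 1) \<and>
     real (ramsey_bound j (2 * n\<^sup>2 + 1)) \<le> twr (Suc j) (real n ^ c)" by blast
  have "2 \<le> ramsey_bound (Suc j) (2 * n\<^sup>2 + 1) \<and>
     real (ramsey_bound (Suc j) (2 * n\<^sup>2 + 1)) \<le> twr (Suc (Suc j)) (real n ^ (c * (j + 4)))"
    if n: "2 \<le> n" for n
  proof -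
    define M where "M = ramsey_bound j (2 * n\<^sup>2 + 1)"
    have M: "2 \<le> M" "real M \<le> twr (Suc j) (real n ^ c)" using IH[OF n] by (auto simp: M_def)
    \<comment> \<open>With \<open>2 \<le> M\<close>, the added one costs at most one further factor
      \<open>M\<close>, so the exponent of two is at most \<open>M ^ (j + 4)\<close>.\<close>
    have "M ^ (j + 2) + 1 \<le> 2 * M ^ (j + 2)" using M(1) by simp
    also have "\<dots> \<le> M * M ^ (j + 2)" using M(1) by (intro mult_right_mono) auto
    finally have "M * (M ^ (j + 2) + 1) \<le> M * (M * M ^ (j + 2))" by (intro mult_left_mono) auto
    also have "\<dots> = M ^ (j + 4)" by (simp add: numeral_eq_Suc)
    finally have "real (M * (M ^ (j + 2) + 1)) \<le> real M ^ (j + 4)"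
      by (metis of_nat_le_iff of_nat_power)
    also have "\<dots> \<le> twr (Suc j) (real n ^ c) ^ (j + 4)" using M(2) by (intro power_mono) auto
    also have "\<dots> \<le> twr (Suc j) ((real n ^ c) ^ (j + 4))"
    proof (rule twr_power_le)
      have "2 \<le> real n ^ 1" using n by simp
      also have "\<dots> \<le> real n ^ c" using n c by (intro power_increasing) auto
      finally show "2 \<le> real n ^ c" .
    qed simp
    finally have "2 powr real (M * (M ^ (j + 2) + 1)) \<le> 2 powr twr (Suc j) (real n ^ (c * (j + 4)))"
      unfolding power_mult by (intro powr_mono) auto
    moreover have "real (2 ^ (M * (M ^ (j + 2) + 1))) = 2 powr real (M * (M ^ (j + 2) + 1))"
      by (simp only: powr_realpow zero_less_numeral of_nat_power of_nat_numeral)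
    moreover have "(2::nat) ^ 1 \<le> 2 ^ (M * (M ^ (j + 2) + 1))"
      using M(1) by (intro power_increasing) auto
    ultimately show ?thesis by (simp add: M_def)
  qed
  moreover have "1 \<le> c * (j + 4)" using c by simp
  ultimately show ?case by blast
qed

section \<open>The bound on \<open>OT\<close>\<close>

lemma OT_le: "forces_same_orientation d n N \<Longrightarrow> OT d n \<le> N"
  unfolding OT_def by (rule Least_le)

text \<open>With at most \<open>d\<close> points there are no tuples of length \<open>d + 1\<close>,
  so the orientation condition is vacuous. This settles \<open>n = 0\<close> and
  \<open>n = 1\<close>, which the tower estimate leaves out.\<close>

lemma OT_trivial:
  assumes "n \<le> d"
  shows "OT d n \<le> n"
proof (rule OT_le)
  show "forces_same_orientation d n n"
    unfolding forces_same_orientation_def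
  proof (intro allI impI)
    fix P assume P: "ordered_point_set d P \<and> length P = n \<and> general_position d (set P)"
    have "length ts \<noteq> d + 1" if "subseq ts P" for ts
      using list_emb_length[OF that] P assms by simp
    then show "\<exists>qs. subseq qs P \<and> length qs = n \<and> same_orientation d qs"
      using P by (intro exI[of _ P]) (auto simp: same_orientation_def)
  qed
qed

theorem theorem3:
  fixes d :: nat
  assumes "d \<ge> 3"
  shows "\<exists>c::real. \<forall>n::nat. real (OT d n) \<le> twr d (real n powr c)"
proof -
  obtain j where j: "d = Suc j" using assms by (cases d) auto
  obtain c :: nat where c: "1 \<le> c"
    "\<And>n. 2 \<le> n \<Longrightarrow> real (ramsey_bound j (2 * n\<^sup>2 + 1)) \<le> twr (Suc j) (real n ^ c)"
    using ramsey_bound_le_twr by blast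
  have "real (OT d n) \<le> twr d (real n powr real c)" for n
  proof -
    consider "n = 0" | "n = 1" | "2 \<le> n" by linarith
    then show ?thesis
    proof cases
      case 1
      \<comment> \<open>As \<open>0 powr c = 0\<close>, the bound is the tower at 0; being
        nonnegative suffices because \<open>OT d 0 = 0\<close>.\<close>
      have "0 \<le> twr (Suc i) 0" for i by (cases i) auto
      then show ?thesis using OT_trivial[of 0 d] 1 j by simp
    next
      case 2
      then show ?thesis using OT_trivial[of 1 d] twr_ge[of 1 j] assms j by simp
    next
      case 3
      have "OT d n \<le> ramsey_bound j (2 * n\<^sup>2 + 1)"
        using OT_le[OF forces_same_orientation_ramsey_bound[of j n]] j by simp
      then show ?thesis using c(2)[OF 3] 3 j by (simp add: powr_realpow)
    qed
  qed
  then show ?thesis by blast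
qed

end
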